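(* Let $l$ be a compact metric space. The following statements are equivalent: (1) the identity map of $l$ admits a kinematic expansive suspension; (2) there is a continuous and locally injective map $T\colon l\to\mathbb{R}$, i.e., a continuous map for which there is $\delta>0$ such that if $0<\operatorname{dist}(x,y)<\delta$ then $T(x)\neq T(y)$; (3) $l$ is homeomorphic to a subset of $\mathbb{R}$.
   Context: Given a homeomorphism $f\colon l\to l$ of a compact metric space and a continuous return time function $T\colon l\to\mathbb{R}^+=(0,\infty)$, the suspension of $f$ with return time $T$ is the flow on the quotient of $\{(x,t):x\in l,\ 0\le t\le T(x)\}$ by $(x,T(x))\sim(f(x),0)$ that moves points along the second coordinate at unit speed. Equivalently, a flow is a suspension of $f$ if it has a global section homeomorphic to $l$ whose first return map is $f$; a homeomorphism admits a kinematic expansive suspension if some suspension of it (i.e. for some $T$) is kinematic expansive. A continuous flow $\phi$ on a compact metric space is kinematic expansive if for all $\epsilon>0$ there exists $\delta>0$ such that if $\operatorname{dist}(\phi_t(x),\phi_t(y))<\delta$ for all $t\in\mathbb{R}$ then there exists $s\in\mathbb{R}$ with $|s|<\epsilon$ and $y=\phi_s(x)$ (this does not depend on the metric inducing the topology). *)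

theory Defs
  imports "HOL-Analysis.Analysis"
begin

definition suspension_domain :: "'a set \<Rightarrow> ('a \<Rightarrow> real) \<Rightarrow> ('a \<times> real) set" where
  "suspension_domain l T = {(x, t). x \<in> l \<and> 0 \<le> t \<and> t \<le> T x}"

definition suspension_rel ::
    "'a set \<Rightarrow> ('a \<Rightarrow> 'a) \<Rightarrow> ('a \<Rightarrow> real) \<Rightarrow> (('a \<times> real) \<times> ('a \<times> real)) set" where
  "suspension_rel l f T =
    {(p, q). p \<in> suspension_domain l T \<and> q \<in> suspension_domain l T \<and>
       equivclp (\<lambda>p q. \<exists>x\<in>l. p = (x, T x) \<and> q = (f x, 0)) p q}"

definition suspension_space ::
    "'a set \<Rightarrow> ('a \<Rightarrow> 'a) \<Rightarrow> ('a \<Rightarrow> real) \<Rightarrow> ('a \<times> real) set set" where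
  "suspension_space l f T = suspension_domain l T // suspension_rel l f T"

definition suspension_point ::
    "'a set \<Rightarrow> ('a \<Rightarrow> 'a) \<Rightarrow> ('a \<Rightarrow> real) \<Rightarrow> 'a \<times> real \<Rightarrow> ('a \<times> real) set" where
  "suspension_point l f T p = suspension_rel l f T `` {p}"

definition suspension_topology ::
    "'a::topological_space set \<Rightarrow> ('a \<Rightarrow> 'a) \<Rightarrow> ('a \<Rightarrow> real) \<Rightarrow> ('a \<times> real) set topology" where
  "suspension_topology l f T =
    topology (\<lambda>U. U \<subseteq> suspension_space l f T \<and>
      openin (top_of_set (suspension_domain l T))
        {p \<in> suspension_domain l T. suspension_point l f T p \<in> U})"

text \<open>The next two lemmas confirm that this is the quotient topology.\<close>

lemma openin_suspension_topology:
  "openin (suspension_topology l f T) U \<longleftrightarrow>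
     U \<subseteq> suspension_space l f T \<and>
     openin (top_of_set (suspension_domain l T))
       {p \<in> suspension_domain l T. suspension_point l f T p \<in> U}"
proof -
  let ?S = "suspension_domain l T" and ?\<pi> = "suspension_point l f T"
  let ?P = "\<lambda>U. U \<subseteq> suspension_space l f T \<and> openin (top_of_set ?S) {p \<in> ?S. ?\<pi> p \<in> U}"
  have "istopology ?P"
    unfolding istopology_def
  proof (intro conjI allI impI)
    fix A B assume "?P A" "?P B"
    moreover have "{p \<in> ?S. ?\<pi> p \<in> A \<inter> B} = {p \<in> ?S. ?\<pi> p \<in> A} \<inter> {p \<in> ?S. ?\<pi> p \<in> B}"
      by auto
    ultimately show "A \<inter> B \<subseteq> suspension_space l f T"
      and "openin (top_of_set ?S) {p \<in> ?S. ?\<pi> p \<in> A \<inter> B}"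
      by (auto simp only: openin_Int)
  next
    fix \<K> assume K: "\<forall>K\<in>\<K>. ?P K"
    then show "\<Union>\<K> \<subseteq> suspension_space l f T" by blast
    have "{p \<in> ?S. ?\<pi> p \<in> \<Union>\<K>} = (\<Union>K\<in>\<K>. {p \<in> ?S. ?\<pi> p \<in> K})" by auto
    then show "openin (top_of_set ?S) {p \<in> ?S. ?\<pi> p \<in> \<Union>\<K>}"
      using K by (simp only:) (rule openin_Union, blast)
  qed
  then show ?thesis
    unfolding suspension_topology_def by (simp add: topology_inverse')
qed

lemma quotient_map_suspension_point:
  "quotient_map (top_of_set (suspension_domain l T)) (suspension_topology l f T)
     (suspension_point l f T)"
proof -
  let ?S = "suspension_domain l T" and ?\<pi> = "suspension_point l f T"
  have im: "?\<pi> ` ?S = suspension_space l f T"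
    by (auto simp: suspension_space_def suspension_point_def quotient_def)
  have "{p \<in> ?S. ?\<pi> p \<in> suspension_space l f T} = ?S"
    using im by blast
  then have "openin (suspension_topology l f T) (suspension_space l f T)"
    by (simp add: openin_suspension_topology)
  then have "topspace (suspension_topology l f T) = suspension_space l f T"
    by (meson openin_subset openin_suspension_topology openin_topspace subset_antisym)
  then show ?thesis
    using im by (auto simp: quotient_map_def openin_suspension_topology)
qed

definition continuous_flow :: "'b topology \<Rightarrow> (real \<Rightarrow> 'b \<Rightarrow> 'b) \<Rightarrow> bool" where
  "continuous_flow X \<phi> \<longleftrightarrow>
    continuous_map (prod_topology euclideanreal X) X (\<lambda>(t, x). \<phi> t x) \<and>
    (\<forall>x\<in>topspace X. \<phi> 0 x = x \<and> (\<forall>s t. \<phi> (s + t) x = \<phi> s (\<phi> t x)))"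

text \<open>The last condition prescribes the motion only inside one copy of the fibre over \<open>x\<close>.
  On a compact \<open>l\<close>, \<open>T\<close> is bounded away from zero, and the flow law then determines \<open>\<phi>\<close>
  on the whole suspension space: the suspension flow of \<open>f\<close> with return time \<open>T\<close> is unique.\<close>

definition suspension_flow ::
    "'a::metric_space set \<Rightarrow> ('a \<Rightarrow> 'a) \<Rightarrow> ('a \<Rightarrow> real) \<Rightarrow>
      (real \<Rightarrow> ('a \<times> real) set \<Rightarrow> ('a \<times> real) set) \<Rightarrow> bool" where
  "suspension_flow l f T \<phi> \<longleftrightarrow>
    (\<exists>g. homeomorphism l l f g) \<and>
    continuous_on l T \<and> (\<forall>x\<in>l. 0 < T x) \<and>
    continuous_flow (suspension_topology l f T) \<phi> \<and>
    (\<forall>x\<in>l. \<forall>s t. 0 \<le> s \<and> 0 \<le> t \<and> s + t \<le> T x \<longrightarrow>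
       \<phi> t (suspension_point l f T (x, s)) = suspension_point l f T (x, s + t))"

definition kinematic_expansive :: "'b set \<Rightarrow> ('b \<Rightarrow> 'b \<Rightarrow> real) \<Rightarrow> (real \<Rightarrow> 'b \<Rightarrow> 'b) \<Rightarrow> bool" where
  "kinematic_expansive M d \<phi> \<longleftrightarrow>
    Metric_space M d \<and> compact_space (Metric_space.mtopology M d) \<and>
    continuous_flow (Metric_space.mtopology M d) \<phi> \<and>
    (\<forall>\<epsilon>>0. \<exists>\<delta>>0. \<forall>x\<in>M. \<forall>y\<in>M.
       (\<forall>t. d (\<phi> t x) (\<phi> t y) < \<delta>) \<longrightarrow> (\<exists>s. \<bar>s\<bar> < \<epsilon> \<and> y = \<phi> s x))"

text \<open>A suspension space carries no preferred metric; kinematic expansiveness does not depend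
  on the choice of a metric \<open>d\<close> inducing the quotient topology.\<close>

definition admits_kinematic_expansive_suspension ::
    "'a::metric_space set \<Rightarrow> ('a \<Rightarrow> 'a) \<Rightarrow> bool" where
  "admits_kinematic_expansive_suspension l f \<longleftrightarrow>
    (\<exists>T \<phi> d. suspension_flow l f T \<phi> \<and>
       Metric_space (suspension_space l f T) d \<and>
       Metric_space.mtopology (suspension_space l f T) d = suspension_topology l f T \<and>
       kinematic_expansive (suspension_space l f T) d \<phi>)"

end

theory Submission
  imports Defs
begin

text \<open>
  A suspension of the identity is periodic on every fibre, with period \<open>T x\<close>. Two orbits with equal
  periods that start close together stay close for ever, whereas orbits with different periods
  drift into opposite phase; hence the suspension is kinematic expansive iff \<open>T\<close> is
  locally injective.

  Suppose \<open>T\<close> is locally injective. By compactness, points lying over a short interval of values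
  of \<open>T\<close> fall into finitely many well separated clusters, on each of which \<open>T\<close> is injective. A
  cluster over \<open>[s, s + \<tau>]\<close> has at most one point over \<open>s\<close>, so clusters over consecutive intervals
  join up into chains without branching. Numbering the chains gives a continuous
  \<open>c : l \<rightarrow> \<nat>\<close> for which \<open>(T, c)\<close> is injective, and \<open>T + M * c\<close> with \<open>M\<close> large embeds \<open>l\<close> into the
  real line.
\<close>

section \<open>From a locally injective function to an embedding into the real line\<close>

text \<open>On the compact set of pairs at distance between \<open>a\<close> and \<open>b\<close>
  the function \<open>\<bar>T x - T y\<bar>\<close> attains its minimum. It is positive, as
  \<open>a\<close> keeps off the diagonal and \<open>b\<close> inside the range of local
  injectivity; half of it makes the bound strict.\<close>

lemma locally_injective_gap:
  fixes T :: "'a::metric_space \<Rightarrow> real"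
  assumes "compact l" "continuous_on l T"
    and inj: "\<And>x y. \<lbrakk>x \<in> l; y \<in> l; 0 < dist x y; dist x y < \<delta>\<rbrakk> \<Longrightarrow> T x \<noteq> T y"
    and "0 < a" "b < \<delta>"
  obtains \<tau> where "0 < \<tau>"
    "\<And>x y. \<lbrakk>x \<in> l; y \<in> l; a \<le> dist x y; dist x y \<le> b\<rbrakk> \<Longrightarrow> \<tau> < \<bar>T x - T y\<bar>"
proof -
  define K where "K = (l \<times> l) \<inter> {p. a \<le> dist (fst p) (snd p) \<and> dist (fst p) (snd p) \<le> b}"
  have "closed {p::'a \<times> 'a. a \<le> dist (fst p) (snd p) \<and> dist (fst p) (snd p) \<le> b}"
    by (intro closed_Collect_conj closed_Collect_le continuous_intros)
  then have K: "compact K"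
    unfolding K_def using assms(1) by (intro compact_Int_closed compact_Times)
  have cont: "continuous_on K (\<lambda>p. \<bar>T (fst p) - T (snd p)\<bar>)"
    by (intro continuous_intros continuous_on_compose2[OF assms(2)]) (auto simp: K_def)
  show ?thesis
  proof (cases "K = {}")
    case True
    then show ?thesis
      by (intro that[of 1]) (auto simp: K_def)
  next
    case False
    then obtain p where p: "p \<in> K" and
      min: "\<And>q. q \<in> K \<Longrightarrow> \<bar>T (fst p) - T (snd p)\<bar> \<le> \<bar>T (fst q) - T (snd q)\<bar>"
      using continuous_attains_inf[OF K _ cont] by blast
    have "T (fst p) \<noteq> T (snd p)"
      using p assms(4,5) by (intro inj) (auto simp: K_def)
    moreover have "\<bar>T (fst p) - T (snd p)\<bar> \<le> \<bar>T x - T y\<bar>"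
      if "x \<in> l" "y \<in> l" "a \<le> dist x y" "dist x y \<le> b" for x y
      using min[of "(x, y)"] that by (simp add: K_def)
    ultimately have "\<bar>T (fst p) - T (snd p)\<bar> / 2 < \<bar>T x - T y\<bar>"
      if "x \<in> l" "y \<in> l" "a \<le> dist x y" "dist x y \<le> b" for x y
      using that by (smt (verit, best) field_sum_of_halves)
    with \<open>T (fst p) \<noteq> T (snd p)\<close> show ?thesis
      by (intro that[of "\<bar>T (fst p) - T (snd p)\<bar> / 2"]) auto
  qed
qed

text \<open>By \<open>gap\<close>, being closer than \<open>r\<close> is transitive on
  \<open>K\<close>: two steps stay below \<open>2 * r\<close>, hence below \<open>r\<close>. The
  classes are relatively open, so compactness leaves finitely many of them to number.\<close>

lemma cluster_labelling:
  fixes K :: "'a::metric_space set"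
  assumes "compact K" "0 < r"
    and gap: "\<And>x y. \<lbrakk>x \<in> K; y \<in> K; dist x y < 2 * r\<rbrakk> \<Longrightarrow> dist x y < r"
  obtains \<kappa> :: "'a \<Rightarrow> nat" where
    "\<And>x y. \<lbrakk>x \<in> K; y \<in> K\<rbrakk> \<Longrightarrow> \<kappa> x = \<kappa> y \<longleftrightarrow> dist x y < r"
proof -
  have trans: "dist x z < r" if "x \<in> K" "y \<in> K" "z \<in> K" "dist x y < r" "dist y z < r" for x y z
    using gap[of x z] that dist_triangle[of x z y] by linarith
  obtain P where P: "finite P" "P \<subseteq> K" "K \<subseteq> (\<Union>p\<in>P. ball p r)"
    using compactE_image[OF assms(1), of K "\<lambda>p. ball p r"] assms(2)
    by (metis UN_I centre_in_ball open_ball subsetI)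
  obtain n :: nat and f where f: "P = f ` {i. i < n}"
    using finite_imp_nat_seg_image_inj_on[OF P(1)] by blast
  \<comment> \<open>The index of the first centre within \<open>r\<close>. Points of one class see
    exactly the same centres, so they get the same index.\<close>
  define \<kappa> where "\<kappa> x = (LEAST i. i < n \<and> dist (f i) x < r)" for x
  have \<kappa>: "\<kappa> x < n \<and> dist (f (\<kappa> x)) x < r" if "x \<in> K" for x
  proof -
    have "x \<in> (\<Union>p\<in>P. ball p r)"
      using that P(3) by blast
    then have "\<exists>p\<in>P. dist p x < r"
      by simp
    then have "\<exists>i. i < n \<and> dist (f i) x < r"
      using f by blast
    then show ?thesis
      unfolding \<kappa>_def by (rule LeastI_ex)
  qed
  show ?thesis
  proof (intro that iffI)
    fix x y assume xy: "x \<in> K" "y \<in> K"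
    { assume "\<kappa> x = \<kappa> y"
      then show "dist x y < r"
        using \<kappa>[of x] \<kappa>[of y] xy trans[of x "f (\<kappa> x)" y] P(2) f by (auto simp: dist_commute) }
    { assume "dist x y < r"
      then have "dist (f i) x < r \<longleftrightarrow> dist (f i) y < r" if "i < n" for i
        using trans[of "f i" x y] trans[of "f i" y x] xy P(2) f that by (auto simp: dist_commute)
      then show "\<kappa> x = \<kappa> y"
        unfolding \<kappa>_def by metis }
  qed
qed

text \<open>The induction step that raises the level by \<open>\<tau>\<close>. Values of
  \<open>T\<close> in the slab differ by at most \<open>\<tau>\<close>, so \<open>gap\<close>
  forbids distances between \<open>r\<close> and \<open>2 * r\<close> there, and the slab splits
  into clusters on which \<open>T\<close> is injective.\<close>

lemma sublevel_labelling_extend: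
  fixes T :: "'a::metric_space \<Rightarrow> real" and c :: "'a \<Rightarrow> nat"
  assumes l: "compact l" and T: "continuous_on l T"
    and inj: "\<And>x y. \<lbrakk>x \<in> l; y \<in> l; 0 < dist x y; dist x y < r\<rbrakk> \<Longrightarrow> T x \<noteq> T y"
    and r: "0 < r"
    and gap: "\<And>x y. \<lbrakk>x \<in> l; y \<in> l; r \<le> dist x y; dist x y \<le> 2 * r\<rbrakk> \<Longrightarrow> \<tau> < \<bar>T x - T y\<bar>"
    and c: "continuous_on {x \<in> l. T x \<le> s} c"
      "\<And>x y. \<lbrakk>x \<in> l; y \<in> l; T x \<le> s; T x = T y; c x = c y\<rbrakk> \<Longrightarrow> x = y"
  obtains c' :: "'a \<Rightarrow> nat" where "continuous_on {x \<in> l. T x \<le> s + \<tau>} c'"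
      "\<And>x y. \<lbrakk>x \<in> l; y \<in> l; T x \<le> s + \<tau>; T x = T y; c' x = c' y\<rbrakk> \<Longrightarrow> x = y"
proof -
  define A where "A = {x \<in> l. T x \<le> s}"
  define B where "B = {x \<in> l. s \<le> T x \<and> T x \<le> s + \<tau>}"
  have clA: "closed A" and clB: "closed B"
  proof -
    have "A = l \<inter> T -` {..s}" "B = l \<inter> T -` {s..s+\<tau>}"
      by (auto simp: A_def B_def)
    then show "closed A" "closed B"
      using continuous_closed_preimage[OF T] compact_imp_closed[OF l] by auto
  qed
  have cB: "compact B"
    using compact_Int_closed[OF l clB] by (simp add: B_def Int_def conj_ac)
  have near: "dist x y < r" if "x \<in> B" "y \<in> B" "dist x y < 2 * r" for x y
    using gap[of x y] that by (force simp: B_def)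
  obtain \<kappa> :: "'a \<Rightarrow> nat" where
    \<kappa>: "\<And>x y. \<lbrakk>x \<in> B; y \<in> B\<rbrakk> \<Longrightarrow> \<kappa> x = \<kappa> y \<longleftrightarrow> dist x y < r"
    using cluster_labelling[OF cB r near] by blast
  \<comment> \<open>\<open>Z x z\<close>: the cluster of \<open>x\<close> meets the level \<open>s\<close> in \<open>z\<close>. Such clusters inherit the label of \<open>z\<close>,
    the others get new labels; the parity of the label tells the two kinds apart.\<close>
  define Z where "Z x z \<longleftrightarrow> z \<in> B \<and> T z = s \<and> \<kappa> z = \<kappa> x" for x z
  \<comment> \<open>Two points of one cluster are closer than \<open>r\<close>; sharing the value
    \<open>s\<close> of \<open>T\<close>, they coincide by local injectivity.\<close>
  have Z_unique: "z = w" if "Z x z" "Z x w" for x z w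
    using that inj[of z w] \<kappa>[of z w] by (force simp: Z_def B_def)
  define g where "g x = (if \<exists>z. Z x z then 2 * c (THE z. Z x z) else 2 * \<kappa> x + 1)" for x
  have g_Z: "g x = 2 * c z" if "Z x z" for x z
    using Z_unique that by (auto simp: g_def intro!: arg_cong[of _ _ c] the_equality)
  define c' where "c' x = (if T x \<le> s then 2 * c x else g x)" for x
  \<comment> \<open>\<open>g\<close> depends on \<open>x\<close> only through
    \<open>\<kappa> x\<close>, which is constant near each point of \<open>B\<close>, so
    \<open>g\<close> is locally constant.\<close>
  have contg: "continuous_on B g"
    unfolding continuous_on_topological
  proof (intro ballI allI impI)
    fix x U assume x: "x \<in> B" "g x \<in> U"
    have "g y = g x" if "y \<in> B" "y \<in> ball x r" for y
    proof -
      have "\<kappa> y = \<kappa> x"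
        using \<kappa>[of x y] that x(1) by simp
      then have "Z y = Z x"
        by (simp add: Z_def fun_eq_iff)
      then show ?thesis
        using \<open>\<kappa> y = \<kappa> x\<close> by (simp add: g_def)
    qed
    then show "\<exists>A. open A \<and> x \<in> A \<and> (\<forall>y\<in>B. y \<in> A \<longrightarrow> g y \<in> U)"
      using x(2) r by (intro exI[of _ "ball x r"]) auto
  qed
  have contA: "continuous_on A (\<lambda>x. 2 * c x)"
  proof -
    have "continuous_on UNIV (\<lambda>n::nat. 2 * n)" by simp
    then show ?thesis
      using c(1) unfolding A_def by (rule continuous_on_compose2) auto
  qed
  have "continuous_on (A \<union> B) c'"
    unfolding c'_def
  proof (rule continuous_on_cases[OF clA clB contA contg])
    \<comment> \<open>The closed pieces meet only at the level \<open>s\<close>, where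
      \<open>x\<close> is itself the point that its cluster has on that level.\<close>
    show "\<forall>x. x \<in> A \<and> \<not> T x \<le> s \<or> x \<in> B \<and> T x \<le> s \<longrightarrow> 2 * c x = g x"
      using g_Z[of x x for x] by (auto simp: A_def B_def Z_def)
  qed
  moreover have "{x \<in> l. T x \<le> s + \<tau>} \<subseteq> A \<union> B"
    by (auto simp: A_def B_def)
  ultimately have "continuous_on {x \<in> l. T x \<le> s + \<tau>} c'"
    using continuous_on_subset by blast
  moreover have "x = y" if xy: "x \<in> l" "y \<in> l" "T x \<le> s + \<tau>" "T x = T y" "c' x = c' y" for x y
  proof (cases "T x \<le> s")
    case True
    then show ?thesis using xy c(2) by (simp add: c'_def)
  next
    case False
    then have B: "x \<in> B" "y \<in> B" and g: "g x = g y"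
      using xy by (auto simp: B_def c'_def)
    \<comment> \<open>Equal labels have equal parity. If both are inherited, \<open>c\<close>
      separates points of the level \<open>s\<close>, so both clusters contain the same point of it;
      if both are new, they encode the cluster.\<close>
    have "\<kappa> x = \<kappa> y"
    proof (cases "(\<exists>z. Z x z) \<and> (\<exists>z. Z y z)")
      case True
      then obtain z w where zw: "Z x z" "Z y w" by blast
      then have "z = w"
        using g g_Z c(2)[of z w] by (auto simp: Z_def B_def)
      then show ?thesis using zw by (simp add: Z_def)
    next
      case False
      moreover have "2 * a \<noteq> 2 * b + (1::nat)" "2 * b + 1 \<noteq> 2 * a" for a b by presburger+
      ultimately have "\<not> (\<exists>z. Z x z)" "\<not> (\<exists>z. Z y z)"
        using g unfolding g_def by metis+
      then show ?thesis
        using g by (simp add: g_def)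
    qed
    then have "dist x y < r" using \<kappa> B by simp
    then show ?thesis
      using inj[of x y] xy by force
  qed
  ultimately show ?thesis by (rule that)
qed

lemma locally_injective_imp_homeomorphic_real_subset:
  fixes T :: "'a::metric_space \<Rightarrow> real"
  assumes l: "compact l" and T: "continuous_on l T" and "0 < \<delta>"
    and inj: "\<And>x y. \<lbrakk>x \<in> l; y \<in> l; 0 < dist x y; dist x y < \<delta>\<rbrakk> \<Longrightarrow> T x \<noteq> T y"
  shows "\<exists>S::real set. l homeomorphic S"
proof -
  \<comment> \<open>With a third, both \<open>r\<close> and \<open>2 * r\<close> stay inside the
    range of local injectivity.\<close>
  define r where "r = \<delta> / 3"
  have r: "0 < r" "r < \<delta>" "2 * r < \<delta>"
    using assms(3) by (auto simp: r_def)
  obtain \<tau> where "0 < \<tau>" and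
    gap: "\<And>x y. \<lbrakk>x \<in> l; y \<in> l; r \<le> dist x y; dist x y \<le> 2 * r\<rbrakk> \<Longrightarrow> \<tau> < \<bar>T x - T y\<bar>"
    using locally_injective_gap[OF l T inj r(1,3)] by blast
  \<comment> \<open>Adding 1 makes the bound strict: the sublevel set at \<open>- b\<close>, where
    the induction starts, is then empty, and \<open>2 * b\<close> exceeds every difference of values
    of \<open>T\<close>.\<close>
  obtain b where b: "\<And>x. x \<in> l \<Longrightarrow> \<bar>T x\<bar> < b"
  proof -
    obtain b where "\<forall>x \<in> T ` l. norm x \<le> b"
      using compact_imp_bounded[OF compact_continuous_image[OF T l]] bounded_iff by blast
    then show ?thesis
      by (intro that[of "b + 1"]) force
  qed
  have labels: "\<exists>c::'a \<Rightarrow> nat. continuous_on {x \<in> l. T x \<le> - b + real k * \<tau>} c \<and>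
    (\<forall>x\<in>l. \<forall>y\<in>l. T x \<le> - b + real k * \<tau> \<longrightarrow> T x = T y \<longrightarrow> c x = c y \<longrightarrow> x = y)" for k
  proof (induction k)
    case 0
    have "{x \<in> l. T x \<le> - b} = {}"
      using b by force
    then show ?case
      by (intro exI[of _ "\<lambda>_. 0"]) auto
  next
    case (Suc k)
    then obtain c :: "'a \<Rightarrow> nat" where c:
      "continuous_on {x \<in> l. T x \<le> - b + real k * \<tau>} c"
      "\<And>x y. \<lbrakk>x \<in> l; y \<in> l; T x \<le> - b + real k * \<tau>; T x = T y; c x = c y\<rbrakk> \<Longrightarrow> x = y"
      by blast
    have inj': "T x \<noteq> T y" if "x \<in> l" "y \<in> l" "0 < dist x y" "dist x y < r" for x y
      using inj[of x y] that r(2) by linarith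
    have step: "- b + real (Suc k) * \<tau> = - b + real k * \<tau> + \<tau>"
      by (simp add: algebra_simps)
    show ?case
      unfolding step by (rule sublevel_labelling_extend[OF l T inj' r(1) gap c]) blast+
  qed
  \<comment> \<open>Enough steps of length \<open>\<tau>\<close> to climb from \<open>- b\<close> to
    \<open>b\<close>.\<close>
  obtain k where "2 * b \<le> real k * \<tau>"
    using reals_Archimedean3[OF \<open>0 < \<tau>\<close>] less_imp_le by blast
  then have le: "T x \<le> - b + real k * \<tau>" if "x \<in> l" for x
    using b[OF that] by linarith
  then have "{x \<in> l. T x \<le> - b + real k * \<tau>} = l" by blast
  with labels[of k] le obtain c :: "'a \<Rightarrow> nat" where c: "continuous_on l c"
    "\<And>x y. \<lbrakk>x \<in> l; y \<in> l; T x = T y; c x = c y\<rbrakk> \<Longrightarrow> x = y"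
    by auto
  \<comment> \<open>Different labels shift values by at least \<open>2 * b\<close>, which no
    difference of values of \<open>T\<close> can compensate.\<close>
  define h where "h x = T x + 2 * b * real (c x)" for x
  have "continuous_on UNIV real" by simp
  then have label: "continuous_on l (\<lambda>x. real (c x))"
    by (rule continuous_on_compose2[OF _ c(1)]) simp
  then have "continuous_on l h"
    unfolding h_def by (intro continuous_on_add continuous_on_mult_left T label)
  moreover have "inj_on h l"
  proof (rule inj_onI)
    fix x y assume xy: "x \<in> l" "y \<in> l" "h x = h y"
    have "c x = c y"
    proof (rule ccontr)
      assume "c x \<noteq> c y"
      then have "1 \<le> \<bar>real (c x) - real (c y)\<bar>" by linarith
      then have "2 * b \<le> 2 * b * \<bar>real (c x) - real (c y)\<bar>"
        using b[OF xy(1)] mult_left_mono[of 1 _ "2 * b"] by force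
      also have "\<dots> = \<bar>2 * b * real (c x) - 2 * b * real (c y)\<bar>"
        using b[OF xy(1)] by (simp add: abs_mult flip: right_diff_distrib)
      also have "\<dots> = \<bar>T y - T x\<bar>"
        using xy(3) by (simp add: h_def)
      finally show False
        using b[OF xy(1)] b[OF xy(2)] by linarith
    qed
    then show "x = y"
      using xy c(2) by (simp add: h_def)
  qed
  ultimately show ?thesis
    using homeomorphic_compact[OF l] by blast
qed

section \<open>Rotations of the unit circle\<close>

lemma cis_eq_cis_iff: "cis a = cis b \<longleftrightarrow> (\<exists>n::int. a = b + 2 * pi * n)"
  using sin_cos_eq_iff[of a b] by (auto simp: complex_eq_iff)

text \<open>The quotient \<open>w / z\<close> is as close to 1 as \<open>w\<close> is to
  \<open>z\<close>, and \<open>Arg\<close> is continuous at 1 with value 0, so the argument of the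
  quotient is a small angle.\<close>

lemma close_on_circle_imp_small_rotation:
  assumes "0 < \<eta>"
  obtains \<delta> where "0 < \<delta>"
    "\<And>z w. \<lbrakk>norm z = 1; norm w = 1; dist z w < \<delta>\<rbrakk> \<Longrightarrow> \<exists>\<theta>. \<bar>\<theta>\<bar> < \<eta> \<and> w = cis \<theta> * z"
proof -
  have "isCont Arg 1"
    by (intro continuous_at_Arg) auto
  then obtain \<delta> where "0 < \<delta>" and \<delta>: "\<And>u. dist u 1 < \<delta> \<Longrightarrow> dist (Arg u) (Arg 1) < \<eta>"
    using assms unfolding continuous_at_eps_delta by metis
  show ?thesis
  proof (rule that[OF \<open>0 < \<delta>\<close>])
    fix z w :: complex assume zw: "norm z = 1" "norm w = 1" "dist z w < \<delta>"
    then have "z \<noteq> 0" by auto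
    then have "w / z - 1 = (w - z) / z"
      by (simp add: field_simps)
    then have "dist (w / z) 1 < \<delta>"
      using zw by (simp add: dist_norm norm_divide norm_minus_commute)
    moreover have "norm (w / z) = 1" "w / z \<noteq> 0"
      using zw by (auto simp: norm_divide)
    then have "cis (Arg (w / z)) = w / z"
      by (simp add: cis_Arg sgn_div_norm)
    ultimately show "\<exists>\<theta>. \<bar>\<theta>\<bar> < \<eta> \<and> w = cis \<theta> * z"
      using \<delta>[of "w / z"] \<open>z \<noteq> 0\<close> by (intro exI[of _ "Arg (w / z)"]) (simp add: dist_real_def)
  qed
qed

text \<open>The phase difference changes at the nonzero rate \<open>a - b\<close>, so at some time,
  possibly negative, the two points are antipodal.\<close>

lemma rotations_at_different_speed_separate:
  assumes "a \<noteq> b" "norm z = 1" "norm w = 1"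
  obtains t where "dist (cis (t * a) * z) (cis (t * b) * w) = 2"
proof -
  define \<theta> where "\<theta> = Arg (- w / z)"
  have "z \<noteq> 0" "w \<noteq> 0" using assms by auto
  then have "cis \<theta> = - w / z"
    using assms unfolding \<theta>_def by (simp add: cis_Arg sgn_div_norm norm_divide)
  then have "cis \<theta> * z = - w"
    using \<open>z \<noteq> 0\<close> by simp
  define t where "t = \<theta> / (a - b)"
  have "t * a = t * b + \<theta>"
    using assms(1) by (simp add: t_def field_simps)
  then have "cis (t * a) * z = cis (t * b) * (cis \<theta> * z)"
    by (simp flip: cis_mult)
  then have "cis (t * a) * z - cis (t * b) * w = - 2 * (cis (t * b) * w)"
    using \<open>cis \<theta> * z = - w\<close> by simp
  then have "dist (cis (t * a) * z) (cis (t * b) * w) = norm (- 2 * (cis (t * b) * w))"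
    by (simp only: dist_norm)
  also have "\<dots> = 2"
    using assms(3) by (simp add: norm_mult)
  finally have "dist (cis (t * a) * z) (cis (t * b) * w) = 2" .
  then show ?thesis by (rule that)
qed

section \<open>Transport of metrics and flows along homeomorphisms\<close>

text \<open>Injectivity of \<open>e\<close> makes the pulled back distance separate points. Its
  balls are preimages of balls of \<open>S\<close>, so for both topologies a set is open iff its
  image is open in \<open>S\<close>.\<close>

lemma homeomorphic_map_pullback_metric:
  fixes e :: "'b \<Rightarrow> 'm::metric_space"
  assumes e: "homeomorphic_map X (top_of_set S) e"
  shows "Metric_space (topspace X) (\<lambda>p q. dist (e p) (e q))"
    and "Metric_space.mtopology (topspace X) (\<lambda>p q. dist (e p) (e q)) = X"
proof -
  have inj: "inj_on e (topspace X)" and im: "e ` topspace X = S"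
    using e by (auto simp: homeomorphic_eq_everything_map)
  show M: "Metric_space (topspace X) (\<lambda>p q. dist (e p) (e q))"
    using inj by unfold_locales (auto simp: dist_commute inj_on_eq_iff intro: dist_triangle)
  interpret Metric_space "topspace X" "\<lambda>p q. dist (e p) (e q)" by (rule M)
  show "mtopology = X"
    unfolding topology_eq
  proof
    fix U
    show "openin mtopology U \<longleftrightarrow> openin X U"
    proof (cases "U \<subseteq> topspace X")
      case True
      have ball: "mball p r \<subseteq> U \<longleftrightarrow> (\<forall>y\<in>S. dist y (e p) < r \<longrightarrow> y \<in> e ` U)"
        if "p \<in> topspace X" for p r
        using inj im that True by (auto simp: subset_iff mball_def dist_commute inj_on_image_mem_iff)
      have "openin mtopology U \<longleftrightarrow> (\<forall>p\<in>U. \<exists>r>0. mball p r \<subseteq> U)"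
        using True by (auto simp: openin_mtopology)
      also have "\<dots> \<longleftrightarrow> (\<forall>p\<in>U. \<exists>r>0. \<forall>y\<in>S. dist y (e p) < r \<longrightarrow> y \<in> e ` U)"
        using ball True by (meson subsetD)
      also have "\<dots> \<longleftrightarrow> openin (top_of_set S) (e ` U)"
        using True im by (auto simp: openin_euclidean_subtopology_iff)
      also have "\<dots> \<longleftrightarrow> openin X U"
        using e True by (rule homeomorphic_map_openness)
      finally show ?thesis .
    next
      case False
      then show ?thesis
        using openin_subset topspace_mtopology by metis
    qed
  qed
qed

text \<open>Gives a flow on the suspension space from rotations in coordinates, without a case
  distinction at the seam.\<close>

lemma continuous_flow_conjugate:
  assumes e: "homeomorphic_maps X Y e e'" and \<psi>: "continuous_flow Y \<psi>"
  shows "continuous_flow X (\<lambda>t p. e' (\<psi> t (e p)))"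
proof -
  have ce: "continuous_map X Y e" and ce': "continuous_map Y X e'"
    and inv: "\<And>p. p \<in> topspace X \<Longrightarrow> e' (e p) = p" "\<And>y. y \<in> topspace Y \<Longrightarrow> e (e' y) = y"
    using e by (auto simp: homeomorphic_maps_def)
  have c\<psi>: "continuous_map (prod_topology euclideanreal Y) Y (\<lambda>(t, y). \<psi> t y)"
    and \<psi>_flow: "\<And>y. y \<in> topspace Y \<Longrightarrow> \<psi> 0 y = y" "\<And>y s t. y \<in> topspace Y \<Longrightarrow> \<psi> (s + t) y = \<psi> s (\<psi> t y)"
    using \<psi> by (auto simp: continuous_flow_def)
  have e_in: "e p \<in> topspace Y" if "p \<in> topspace X" for p
    using ce that by (auto simp: continuous_map_def)
  have \<psi>_in: "\<psi> t y \<in> topspace Y" if "y \<in> topspace Y" for t y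
    using c\<psi> that by (auto simp: continuous_map_def Pi_iff)
  have "continuous_map (prod_topology euclideanreal X) (prod_topology euclideanreal Y) (\<lambda>(t, p). (t, e p))"
    by (auto simp: continuous_map_pairwise o_def case_prod_unfold
        intro: continuous_map_fst continuous_map_compose[OF continuous_map_snd ce, unfolded o_def])
  from continuous_map_compose[OF continuous_map_compose[OF this c\<psi>] ce']
  have "continuous_map (prod_topology euclideanreal X) X (\<lambda>(t, p). e' (\<psi> t (e p)))"
    by (simp add: o_def case_prod_unfold)
  then show ?thesis
    using inv \<psi>_flow e_in \<psi>_in by (simp add: continuous_flow_def)
qed

section \<open>Periodic fibres and uniform continuity\<close>

text \<open>The seam identifies \<open>(x, T x)\<close> with \<open>(x, 0)\<close>, so
  \<open>T x\<close> is a period. Reducing \<open>t\<close> modulo this period leaves a time at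
  which the motion is prescribed.\<close>

lemma suspension_flow_id_periodic:
  assumes flow: "suspension_flow l id T \<phi>" and x: "x \<in> l"
  shows "\<phi> t (suspension_point l id T (x, 0)) = suspension_point l id T (x, T x * frac (t / T x))"
proof -
  define P where "P = suspension_point l id T (x, 0)"
  have Tx: "0 < T x" using flow x by (simp add: suspension_flow_def)
  have P: "P \<in> topspace (suspension_topology l id T)"
    using quotient_imp_surjective_map[OF quotient_map_suspension_point, of l id T] x Tx
    by (force simp: P_def suspension_domain_def)
  have flow0: "\<phi> 0 P = P" and flow_add: "\<phi> (s + u) P = \<phi> s (\<phi> u P)" for s u
    using flow P by (auto simp: suspension_flow_def continuous_flow_def)
  have move: "\<phi> s P = suspension_point l id T (x, s)" if "0 \<le> s" "s \<le> T x" for s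
  proof -
    have "\<phi> s (suspension_point l id T (x, 0)) = suspension_point l id T (x, 0 + s)"
      using flow x that unfolding suspension_flow_def by (metis add_0 order_refl)
    then show ?thesis by (simp add: P_def)
  qed
  have "suspension_point l id T (x, T x) = P"
    using x Tx unfolding P_def suspension_point_def suspension_rel_def
    by (auto simp: suspension_domain_def intro: equivclp_trans[OF r_into_equivclp]
        equivclp_trans[OF converse_r_into_equivclp])
  then have period: "\<phi> (T x) P = P"
    using move[of "T x"] Tx by simp
  have nat_period: "\<phi> (of_nat n * T x) P = P" for n
    by (induction n) (simp_all add: flow0 flow_add period distrib_right)
  have int_period: "\<phi> (of_int n * T x) P = P" for n
  proof (cases n)
    case (nonneg m)
    then show ?thesis using nat_period by simp
  next
    case (neg m)
    \<comment> \<open>The positive multiple of the period fixes \<open>P\<close>; followed by the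
      negative multiple, it adds up to time 0.\<close>
    have "\<phi> (of_int n * T x + of_nat (Suc m) * T x) P = \<phi> (of_int n * T x) P"
      unfolding flow_add nat_period ..
    moreover have "of_int n = - real (Suc m)"
      using neg by simp
    then have "of_int n * T x + of_nat (Suc m) * T x = 0"
      by (simp only:)
    ultimately show ?thesis using flow0 by simp
  qed
  have "t = T x * frac (t / T x) + of_int \<lfloor>t / T x\<rfloor> * T x"
    using Tx by (simp add: frac_def field_simps)
  then have "\<phi> t P = \<phi> (T x * frac (t / T x)) P"
    using flow_add int_period by metis
  also have "\<dots> = suspension_point l id T (x, T x * frac (t / T x))"
    using Tx frac_lt_1[of "t / T x"] mult_left_le[of "frac (t / T x)" "T x"] by (intro move) auto
  finally show ?thesis by (simp add: P_def)
qed

text \<open>Take a Lebesgue number of a cover of \<open>S\<close> by open sets \<open>U p\<close> on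
  which \<open>f\<close> stays within \<open>\<epsilon> / 2\<close> of \<open>f p\<close>.\<close>

lemma continuous_map_compact_into_metric_uniform:
  fixes f :: "'a::metric_space \<Rightarrow> 'b"
  assumes "compact S" "Metric_space M d"
    and f: "continuous_map (top_of_set S) (Metric_space.mtopology M d) f" and "0 < \<epsilon>"
  obtains \<delta> where "0 < \<delta>" "\<And>x y. \<lbrakk>x \<in> S; y \<in> S; dist x y < \<delta>\<rbrakk> \<Longrightarrow> d (f x) (f y) < \<epsilon>"
proof -
  interpret Metric_space M d by fact
  have fM: "f x \<in> M" if "x \<in> S" for x
    using continuous_map_funspace[OF f] that by auto
  have "\<exists>U. open U \<and> x \<in> U \<and> (\<forall>y\<in>S \<inter> U. d (f x) (f y) < \<epsilon> / 2)" if x: "x \<in> S" for x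
  proof -
    have "openin (top_of_set S) {y \<in> S. f y \<in> mball (f x) (\<epsilon> / 2)}"
      using openin_continuous_map_preimage[OF f openin_mball] by (simp del: in_mball)
    then obtain U where "open U" "{y \<in> S. f y \<in> mball (f x) (\<epsilon> / 2)} = S \<inter> U"
      by (auto simp: openin_open)
    moreover have "x \<in> {y \<in> S. f y \<in> mball (f x) (\<epsilon> / 2)}"
      using x fM assms(4) by simp
    ultimately show ?thesis
      by (metis (mono_tags, lifting) IntD2 in_mball mem_Collect_eq)
  qed
  then obtain U where U: "\<And>x. x \<in> S \<Longrightarrow> open (U x) \<and> x \<in> U x \<and> (\<forall>y\<in>S \<inter> U x. d (f x) (f y) < \<epsilon> / 2)"
    by metis
  obtain \<delta> where \<delta>: "0 < \<delta>" "\<And>x. x \<in> S \<Longrightarrow> \<exists>G \<in> U ` S. ball x \<delta> \<subseteq> G"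
    by (rule Heine_Borel_lemma[OF assms(1), of "U ` S"]) (use U in auto)
  show ?thesis
  proof (rule that[OF \<delta>(1)])
    fix x y assume xy: "x \<in> S" "y \<in> S" "dist x y < \<delta>"
    then obtain p where p: "p \<in> S" "ball x \<delta> \<subseteq> U p"
      using \<delta>(2) by blast
    then have "x \<in> U p" "y \<in> U p"
      using xy \<delta>(1) by auto
    then have "d (f p) (f x) < \<epsilon> / 2" "d (f p) (f y) < \<epsilon> / 2"
      using U[OF p(1)] xy by auto
    then show "d (f x) (f y) < \<epsilon>"
      using triangle[of "f x" "f p" "f y"] fM xy p(1) commute[of "f p" "f x"] by auto
  qed
qed

text \<open>The suspension space of the identity is homeomorphic to \<open>l\<close> times the unit circle, and the
  metric on it will be pulled back from there.\<close>

definition suspension_coord :: "('a \<Rightarrow> real) \<Rightarrow> 'a \<times> real \<Rightarrow> 'a \<times> complex" where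
  "suspension_coord T p = (fst p, cis (2 * pi * snd p / T (fst p)))"

definition suspension_chart :: "('a \<Rightarrow> real) \<Rightarrow> ('a \<times> real) set \<Rightarrow> 'a \<times> complex" where
  "suspension_chart T P = suspension_coord T (SOME p. p \<in> P)"

text \<open>The suspension flow seen in the chart: unit speed on a fibre of length
  \<open>T x\<close> becomes angular speed \<open>2 * pi / T x\<close>.\<close>

definition fibre_rotation :: "('a \<Rightarrow> real) \<Rightarrow> real \<Rightarrow> 'a \<times> complex \<Rightarrow> 'a \<times> complex" where
  "fibre_rotation T t q = (fst q, cis (2 * pi * t / T (fst q)) * snd q)"

section \<open>Coordinates on the suspension of the identity\<close>

locale positive_roof =
  fixes l :: "'a::metric_space set" and T :: "'a \<Rightarrow> real"
  assumes compact_base: "compact l"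
    and continuous_roof: "continuous_on l T"
    and roof_pos: "\<And>x. x \<in> l \<Longrightarrow> 0 < T x"
begin

abbreviation "Dom \<equiv> suspension_domain l T"
abbreviation "pt \<equiv> suspension_point l id T"
abbreviation "X \<equiv> suspension_topology l id T"

lemma compact_domain: "compact Dom"
proof -
  have "bounded (T ` l)"
    using compact_imp_bounded[OF compact_continuous_image[OF continuous_roof compact_base]] .
  then obtain b where b: "\<And>x. x \<in> l \<Longrightarrow> \<bar>T x\<bar> \<le> b"
    by (auto simp: bounded_iff)
  have K: "compact (l \<times> {0..b})"
    by (intro compact_Times compact_base compact_Icc)
  have "continuous_on (l \<times> {0..b}) (\<lambda>p. T (fst p) - snd p)"
    by (intro continuous_intros continuous_on_compose2[OF continuous_roof]) auto
  then have "closed ((l \<times> {0..b}) \<inter> (\<lambda>p. T (fst p) - snd p) -` {0..})"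
    by (intro continuous_closed_preimage compact_imp_closed[OF K] closed_atLeast)
  moreover have "Dom = (l \<times> {0..b}) \<inter> ((l \<times> {0..b}) \<inter> (\<lambda>p. T (fst p) - snd p) -` {0..})"
    using b by (force simp: suspension_domain_def)
  ultimately show ?thesis
    using compact_Int_closed[OF K] by metis
qed

text \<open>Equal phases force the heights to differ by an integer multiple of \<open>T x\<close>.
  Both lie between 0 and \<open>T x\<close>, so the multiple is 0 or plus or minus 1, the latter
  only for the two ends of the fibre.\<close>

lemma suspension_coord_eq_iff:
  assumes "p \<in> Dom" "q \<in> Dom"
  shows "suspension_coord T p = suspension_coord T q \<longleftrightarrow>
    fst p = fst q \<and> (snd p = snd q \<or> {snd p, snd q} = {0, T (fst p)})"
proof -
  obtain x s y t where pq: "p = (x, s)" "q = (y, t)" by (metis surj_pair)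
  have "s = t \<or> {s, t} = {0, T x}" if "x = y" and cis: "cis (2 * pi * s / T x) = cis (2 * pi * t / T x)"
  proof -
    have Tx: "0 < T x" and st: "0 \<le> s" "s \<le> T x" "0 \<le> t" "t \<le> T x"
      using assms that(1) roof_pos by (auto simp: pq suspension_domain_def)
    obtain n :: int where "2 * pi * s / T x = 2 * pi * t / T x + 2 * pi * n"
      using cis by (auto simp: cis_eq_cis_iff)
    then have "2 * pi * s = 2 * pi * (t + n * T x)"
      using Tx by (simp add: field_simps)
    then have n: "s = t + n * T x" by simp
    have "n = 0 \<or> n = 1 \<or> n = -1"
    proof (rule ccontr)
      assume "\<not> ?thesis"
      then have "2 \<le> n \<or> n \<le> -2" by linarith
      then have "2 * T x \<le> n * T x \<or> n * T x \<le> - 2 * T x"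
        using Tx by (metis mult_right_mono less_imp_le of_int_le_iff of_int_numeral of_int_minus)
      then show False
        using n st Tx by linarith
    qed
    then show ?thesis
      using n st by auto
  qed
  moreover have "cis (2 * pi * s / T x) = cis (2 * pi * t / T x)" if "x = y" "{s, t} = {0, T x}"
    using that assms roof_pos[of x] by (auto simp: pq doubleton_eq_iff suspension_domain_def)
  ultimately show ?thesis
    by (auto simp: pq suspension_coord_def)
qed

text \<open>The coordinate map is constant along the gluing. Conversely it identifies only the two
  ends of a fibre, so at most one gluing step, in either direction, connects points with equal
  coordinates.\<close>

lemma suspension_rel_iff:
  "(p, q) \<in> suspension_rel l id T \<longleftrightarrow>
    p \<in> Dom \<and> q \<in> Dom \<and> suspension_coord T p = suspension_coord T q"
proof -
  let ?R = "\<lambda>p q. \<exists>x\<in>l. p = (x, T x) \<and> q = (id x, 0)"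
  have "suspension_coord T p = suspension_coord T q" if "equivclp ?R p q"
    using that
  proof (induction rule: equivclp_induct)
    case (step y z)
    have "suspension_coord T a = suspension_coord T b" if "?R a b" for a b
      using that roof_pos by (force simp: suspension_coord_def)
    then show ?case using step by metis
  qed simp
  moreover have "equivclp ?R p q"
    if D: "p \<in> Dom" "q \<in> Dom" and "suspension_coord T p = suspension_coord T q"
  proof -
    have eq: "fst p = fst q" "snd p = snd q \<or> {snd p, snd q} = {0, T (fst p)}"
      using that suspension_coord_eq_iff by auto
    have "p = q \<or> ?R p q \<or> ?R q p"
      using eq D by (cases p; cases q) (auto simp: doubleton_eq_iff suspension_domain_def)
    then show ?thesis
    proof (elim disjE)
      assume "?R q p"
      then show ?thesis by (rule converse_r_into_equivclp)
    qed (simp_all only: equivclp_refl r_into_equivclp)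
  qed
  ultimately show ?thesis
    by (auto simp: suspension_rel_def)
qed

text \<open>The representative picked by \<open>SOME\<close> does not matter, because the coordinate
  map is constant on classes.\<close>

lemma suspension_chart_point: "p \<in> Dom \<Longrightarrow> suspension_chart T (pt p) = suspension_coord T p"
proof -
  assume "p \<in> Dom"
  then have "p \<in> pt p"
    by (simp add: suspension_point_def suspension_rel_iff)
  define q where "q = (SOME q. q \<in> pt p)"
  have "q \<in> pt p"
    unfolding q_def using \<open>p \<in> pt p\<close> by (rule someI)
  then have "suspension_coord T p = suspension_coord T q"
    by (simp add: suspension_point_def suspension_rel_iff)
  then show ?thesis
    by (simp only: suspension_chart_def q_def)
qed

lemma suspension_point_eq_iff:
  "\<lbrakk>p \<in> Dom; q \<in> Dom\<rbrakk> \<Longrightarrow> pt p = pt q \<longleftrightarrow> suspension_coord T p = suspension_coord T q"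
  by (metis suspension_chart_point suspension_point_def suspension_rel_iff
      Image_singleton_iff subsetI subset_antisym)

lemma topspace_suspension: "topspace X = pt ` Dom"
  using quotient_imp_surjective_map[OF quotient_map_suspension_point, of l id T] by simp

lemma topspace_suspension_space: "topspace X = suspension_space l id T"
  by (auto simp: topspace_suspension suspension_space_def suspension_point_def quotient_def)

lemma continuous_suspension_coord: "continuous_on Dom (suspension_coord T)"
  unfolding suspension_coord_def
  by (intro continuous_intros continuous_on_compose2[OF continuous_roof])
     (use roof_pos in \<open>force simp: suspension_domain_def\<close>)+

lemma suspension_coord_image: "suspension_coord T ` Dom = l \<times> sphere 0 1"
proof (intro subset_antisym subsetI)
  fix q assume "q \<in> l \<times> sphere (0::complex) 1"
  then obtain x z where q: "q = (x, z)" "x \<in> l" "norm z = 1" by auto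
  have Tx: "0 < T x" using q roof_pos by simp
  have arg: "0 \<le> Arg2pi z" "Arg2pi z < 2 * pi" "cis (Arg2pi z) = z"
    using q(3) Arg2pi[of z] complex_norm_eq_1_exp[of z] by (auto simp: cis_conv_exp)
  have "T x * Arg2pi z / (2 * pi) \<le> T x"
    using arg Tx by (simp add: field_simps)
  then have "(x, T x * Arg2pi z / (2 * pi)) \<in> Dom"
    using q arg Tx by (simp add: suspension_domain_def)
  moreover have "suspension_coord T (x, T x * Arg2pi z / (2 * pi)) = q"
    using arg Tx by (simp add: suspension_coord_def q(1))
  ultimately show "q \<in> suspension_coord T ` Dom" by (metis image_eqI)
qed (auto simp: suspension_coord_def suspension_domain_def)

text \<open>The chart is a continuous bijection from a compact space onto a Hausdorff space; its
  continuity descends from the domain because \<open>pt\<close> is a quotient map.\<close>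

lemma homeomorphic_suspension_chart:
  "homeomorphic_map X (top_of_set (l \<times> sphere 0 1)) (suspension_chart T)"
proof (rule continuous_imp_homeomorphic_map)
  have q: "quotient_map (top_of_set Dom) X pt"
    by (rule quotient_map_suspension_point)
  have "continuous_map (top_of_set Dom) (top_of_set (l \<times> sphere 0 1)) (suspension_chart T \<circ> pt)"
  proof (rule continuous_map_eq)
    show "continuous_map (top_of_set Dom) (top_of_set (l \<times> sphere 0 1)) (suspension_coord T)"
      using continuous_suspension_coord suspension_coord_image by auto
  qed (simp add: suspension_chart_point)
  then show "continuous_map X (top_of_set (l \<times> sphere 0 1)) (suspension_chart T)"
    by (rule continuous_compose_quotient_map[OF q])
  have "compactin (top_of_set Dom) Dom"
    using compact_domain by (simp add: compactin_subtopology)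
  then show "compact_space X"
    using image_compactin[OF _ quotient_imp_continuous_map[OF q]]
    by (simp add: compact_space_def topspace_suspension)
  show "suspension_chart T ` topspace X = topspace (top_of_set (l \<times> sphere 0 1))"
    using suspension_coord_image
    by (simp add: topspace_suspension image_image suspension_chart_point cong: image_cong)
  show "inj_on (suspension_chart T) (topspace X)"
    by (auto simp: topspace_suspension inj_on_def suspension_chart_point suspension_point_eq_iff)
qed (simp add: Hausdorff_space_subtopology)

lemma continuous_flow_fibre_rotation:
  "continuous_flow (top_of_set (l \<times> sphere 0 1)) (fibre_rotation T)"
  unfolding continuous_flow_def
proof (intro conjI ballI allI)
  have "continuous_on (UNIV \<times> (l \<times> sphere 0 1)) (\<lambda>p. fibre_rotation T (fst p) (snd p))"
    unfolding fibre_rotation_def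
    by (intro continuous_intros continuous_on_compose2[OF continuous_roof]) (use roof_pos in force)+
  moreover have "(\<lambda>p. fibre_rotation T (fst p) (snd p)) ` (UNIV \<times> (l \<times> sphere 0 1)) \<subseteq> l \<times> sphere 0 1"
    by (auto simp: fibre_rotation_def norm_mult)
  ultimately show "continuous_map (prod_topology euclideanreal (top_of_set (l \<times> sphere 0 1)))
      (top_of_set (l \<times> sphere 0 1)) (\<lambda>(t, q). fibre_rotation T t q)"
    using prod_topology_subtopology_eu[of "UNIV :: real set" "l \<times> sphere (0::complex) 1"]
    by (simp add: case_prod_unfold image_subset_iff Pi_iff)
  fix q s t assume "q \<in> topspace (top_of_set (l \<times> sphere (0::complex) 1))"
  show "fibre_rotation T 0 q = q"
    by (simp add: fibre_rotation_def)
  show "fibre_rotation T (s + t) q = fibre_rotation T s (fibre_rotation T t q)"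
    by (simp add: fibre_rotation_def cis_mult distrib_left add_divide_distrib flip: mult.assoc)
qed

lemma fibre_rotation_coord:
  "fibre_rotation T t (suspension_coord T (x, s)) = suspension_coord T (x, s + t)"
  by (simp add: fibre_rotation_def suspension_coord_def cis_mult distrib_left add_divide_distrib add.commute)

section \<open>Kinematic expansiveness and local injectivity of the return time\<close>

text \<open>Orbits staying closer than 2 rotate at the same speed, so their return times agree.
  Closeness at time 0 and local injectivity then place them on one fibre, where a small distance
  means a small time shift.\<close>

lemma admits_kinematic_expansive_suspension_id:
  assumes "0 < \<delta>"
    and inj: "\<And>x y. \<lbrakk>x \<in> l; y \<in> l; 0 < dist x y; dist x y < \<delta>\<rbrakk> \<Longrightarrow> T x \<noteq> T y"
  shows "admits_kinematic_expansive_suspension l id"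
proof -
  let ?Y = "top_of_set (l \<times> sphere (0::complex) 1)" and ?e = "suspension_chart T"
  obtain e' where e': "homeomorphic_maps X ?Y ?e e'"
    using homeomorphic_suspension_chart homeomorphic_map_maps by blast
  define \<phi> where "\<phi> t P = e' (fibre_rotation T t (?e P))" for t P
  define d where "d P Q = dist (?e P) (?e Q)" for P Q
  have metric: "Metric_space (suspension_space l id T) d"
      "Metric_space.mtopology (suspension_space l id T) d = X"
    using homeomorphic_map_pullback_metric[OF homeomorphic_suspension_chart]
    by (simp_all add: d_def[abs_def] topspace_suspension_space)
  have \<phi>: "continuous_flow X \<phi>"
    unfolding \<phi>_def[abs_def]
    by (rule continuous_flow_conjugate[OF e' continuous_flow_fibre_rotation])
  have e'_e: "e' (?e P) = P" if "P \<in> topspace X" for P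
    using e' that by (auto simp: homeomorphic_maps_def)
  have e_in: "?e P \<in> l \<times> sphere 0 1" if "P \<in> topspace X" for P
    using homeomorphic_imp_surjective_map[OF homeomorphic_suspension_chart] that by auto
  have e_\<phi>: "?e (\<phi> t P) = fibre_rotation T t (?e P)" if "P \<in> topspace X" for t P
  proof -
    have "fibre_rotation T t (?e P) \<in> l \<times> sphere 0 1"
      using e_in[OF that] by (auto simp: fibre_rotation_def norm_mult)
    then show ?thesis
      using e' by (auto simp: homeomorphic_maps_def \<phi>_def)
  qed
  have flow: "suspension_flow l id T \<phi>"
    unfolding suspension_flow_def
  proof (intro conjI ballI allI impI continuous_roof roof_pos \<phi>)
    show "\<exists>g. homeomorphism l l id g"
      using homeomorphism_ident[of l] by (auto simp: id_def)
    fix x s t assume *: "x \<in> l" "0 \<le> s \<and> 0 \<le> t \<and> s + t \<le> T x"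
    then have D: "(x, s) \<in> Dom" "(x, s + t) \<in> Dom"
      by (auto simp: suspension_domain_def)
    then have "\<phi> t (pt (x, s)) = e' (?e (pt (x, s + t)))"
      by (simp add: \<phi>_def suspension_chart_point fibre_rotation_coord)
    then show "\<phi> t (pt (x, s)) = pt (x, s + t)"
      using D e'_e by (simp add: topspace_suspension)
  qed
  have "bounded (T ` l)"
    using compact_imp_bounded[OF compact_continuous_image[OF continuous_roof compact_base]] .
  then obtain b where b: "0 < b" "\<And>x. x \<in> l \<Longrightarrow> T x \<le> b"
    unfolding bounded_pos by (auto simp: abs_le_iff)
  have expansive: "\<exists>\<eta>>0. \<forall>P\<in>topspace X. \<forall>Q\<in>topspace X.
      (\<forall>t. d (\<phi> t P) (\<phi> t Q) < \<eta>) \<longrightarrow> (\<exists>s. \<bar>s\<bar> < \<epsilon> \<and> Q = \<phi> s P)" if "0 < \<epsilon>" for \<epsilon>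
  proof -
    \<comment> \<open>Turning the fibre over \<open>x\<close> by an angle \<open>\<theta>\<close>
      takes time \<open>\<theta> * T x / (2 * pi)\<close> and \<open>T x \<le> b\<close>, so angles
      below this bound need times below \<open>\<epsilon>\<close>.\<close>
    have "0 < 2 * pi * \<epsilon> / b" using that b by simp
    then obtain \<rho> where \<rho>: "0 < \<rho>" "\<And>z w. \<lbrakk>norm z = 1; norm w = 1; dist z w < \<rho>\<rbrakk>
        \<Longrightarrow> \<exists>\<theta>. \<bar>\<theta>\<bar> < 2 * pi * \<epsilon> / b \<and> w = cis \<theta> * z"
      using close_on_circle_imp_small_rotation by blast
    show ?thesis
    \<comment> \<open>Here 2, the distance of antipodal points, excludes different speeds,
      \<open>\<delta>\<close> gives access to local injectivity, and \<open>\<rho>\<close> makes the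
      rotation angle small.\<close>
    proof (rule exI[of _ "min 2 (min \<delta> \<rho>)"], intro conjI ballI impI)
      show "0 < min 2 (min \<delta> \<rho>)" using assms \<rho> by simp
      fix P Q assume PQ: "P \<in> topspace X" "Q \<in> topspace X"
        and close: "\<forall>t. d (\<phi> t P) (\<phi> t Q) < min 2 (min \<delta> \<rho>)"
      obtain x z y w where xz: "?e P = (x, z)" "x \<in> l" "norm z = 1"
        and yw: "?e Q = (y, w)" "y \<in> l" "norm w = 1"
        using e_in[OF PQ(1)] e_in[OF PQ(2)] by auto
      have close': "dist (fibre_rotation T t (x, z)) (fibre_rotation T t (y, w)) < min 2 (min \<delta> \<rho>)" for t
        using close e_\<phi> PQ by (simp add: d_def xz yw)
      have "T x = T y"
      proof (rule ccontr)
        assume "T x \<noteq> T y"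
        then have "2 * pi / T x \<noteq> 2 * pi / T y"
          using roof_pos xz yw by (simp add: frac_eq_eq)
        then obtain t where "dist (cis (t * (2 * pi / T x)) * z) (cis (t * (2 * pi / T y)) * w) = 2"
          using rotations_at_different_speed_separate xz yw by metis
        moreover have "dist (cis (t * (2 * pi / T x)) * z) (cis (t * (2 * pi / T y)) * w)
            \<le> dist (fibre_rotation T t (x, z)) (fibre_rotation T t (y, w))"
          using dist_snd_le[of "fibre_rotation T t (x, z)" "fibre_rotation T t (y, w)"]
          by (simp add: fibre_rotation_def mult_ac)
        ultimately show False
          using close'[of t] by simp
      qed
      have "dist (x, z) (y, w) < min 2 (min \<delta> \<rho>)"
        using close'[of 0] by (simp add: fibre_rotation_def)
      then have "dist x y < \<delta>" "dist z w < \<rho>"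
        using dist_fst_le[of "(x, z)" "(y, w)"] dist_snd_le[of "(x, z)" "(y, w)"] by auto
      then have "x = y"
        using inj[of x y] \<open>T x = T y\<close> xz yw by fastforce
      obtain \<theta> where \<theta>: "\<bar>\<theta>\<bar> < 2 * pi * \<epsilon> / b" "w = cis \<theta> * z"
        using \<rho>(2) xz yw \<open>dist z w < \<rho>\<close> by blast
      define s where "s = \<theta> * T x / (2 * pi)"
      have Tx: "0 < T x" "T x \<le> b" using b roof_pos xz by auto
      have "\<bar>s\<bar> = \<bar>\<theta>\<bar> * T x / (2 * pi)"
        using Tx by (simp add: s_def abs_mult)
      also have "\<dots> \<le> \<bar>\<theta>\<bar> * b / (2 * pi)"
        using Tx by (intro divide_right_mono mult_left_mono) auto
      also have "\<dots> < \<epsilon>"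
        using \<theta>(1) b by (simp add: field_simps)
      finally have "\<bar>s\<bar> < \<epsilon>" .
      moreover have "fibre_rotation T s (x, z) = (y, w)"
        using Tx \<open>x = y\<close> \<theta>(2) by (simp add: fibre_rotation_def s_def)
      then have "Q = \<phi> s P"
        using e'_e[OF PQ(2)] by (simp add: \<phi>_def xz yw)
      ultimately show "\<exists>s. \<bar>s\<bar> < \<epsilon> \<and> Q = \<phi> s P" by blast
    qed
  qed
  have "compact_space X"
    using homeomorphic_compact_space[OF homeomorphic_map_imp_homeomorphic_space[OF homeomorphic_suspension_chart]]
      compact_Times[OF compact_base compact_sphere[of "0::complex" 1]]
    by (simp add: compact_space_subtopology)
  then have "kinematic_expansive (suspension_space l id T) d \<phi>"
    using metric \<phi> expansive by (simp add: kinematic_expansive_def topspace_suspension_space)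
  then show ?thesis
    using flow metric unfolding admits_kinematic_expansive_suspension_def by blast
qed

text \<open>With equal return times two orbits keep equal heights, so representatives in the domain
  stay at distance \<open>dist x y\<close>; uniform continuity of \<open>pt\<close> makes the orbits
  close in \<open>d\<close>. Expansiveness would put both on one orbit, but an orbit never leaves
  its fibre.\<close>

lemma kinematic_expansive_imp_locally_injective_roof:
  assumes flow: "suspension_flow l id T \<phi>"
    and metric: "Metric_space (suspension_space l id T) d"
      "Metric_space.mtopology (suspension_space l id T) d = X"
    and expansive: "kinematic_expansive (suspension_space l id T) d \<phi>"
  shows "\<exists>\<delta>>0. \<forall>x\<in>l. \<forall>y\<in>l. 0 < dist x y \<and> dist x y < \<delta> \<longrightarrow> T x \<noteq> T y"
proof -
  \<comment> \<open>Any bound on the time shift would serve, since only lying on one orbit matters;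
    it is taken to be 1.\<close>
  obtain \<eta> where \<eta>: "0 < \<eta>" "\<And>P Q. \<lbrakk>P \<in> topspace X; Q \<in> topspace X; \<And>t. d (\<phi> t P) (\<phi> t Q) < \<eta>\<rbrakk>
      \<Longrightarrow> \<exists>s. Q = \<phi> s P"
    using expansive zero_less_one unfolding kinematic_expansive_def topspace_suspension_space by meson
  have "continuous_map (top_of_set Dom) (Metric_space.mtopology (suspension_space l id T) d) pt"
    unfolding metric(2) by (intro quotient_imp_continuous_map quotient_map_suspension_point)
  then obtain \<delta> where \<delta>: "0 < \<delta>" "\<And>p q. \<lbrakk>p \<in> Dom; q \<in> Dom; dist p q < \<delta>\<rbrakk> \<Longrightarrow> d (pt p) (pt q) < \<eta>"
    using continuous_map_compact_into_metric_uniform[OF compact_domain metric(1) _ \<eta>(1)] by blast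
  have fibre: "(x, T x * frac u) \<in> Dom" if "x \<in> l" for x u
    using that roof_pos[OF that] frac_lt_1[of u] mult_left_le[of "frac u" "T x"]
    by (auto simp: suspension_domain_def)
  have base: "(x, 0) \<in> Dom" if "x \<in> l" for x
    using fibre[OF that, of 0] by simp
  have "T x \<noteq> T y" if xy: "x \<in> l" "y \<in> l" "0 < dist x y" "dist x y < \<delta>" for x y
  proof
    assume eq: "T x = T y"
    have "d (\<phi> t (pt (x, 0))) (\<phi> t (pt (y, 0))) < \<eta>" for t
      unfolding suspension_flow_id_periodic[OF flow xy(1)] suspension_flow_id_periodic[OF flow xy(2)]
      using fibre[OF xy(1), of "t / T x"] fibre[OF xy(2), of "t / T y"] xy(4) eq
      by (intro \<delta>(2)) (auto simp: dist_Pair_Pair)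
    then obtain s where "pt (y, 0) = \<phi> s (pt (x, 0))"
      using \<eta>(2)[of "pt (x, 0)" "pt (y, 0)"] base xy by (auto simp: topspace_suspension)
    also have "\<dots> = pt (x, T x * frac (s / T x))"
      by (rule suspension_flow_id_periodic[OF flow xy(1)])
    finally have "suspension_coord T (y, 0) = suspension_coord T (x, T x * frac (s / T x))"
      using suspension_point_eq_iff[OF base[OF xy(2)] fibre[OF xy(1)]] by blast
    then show False
      using xy(3) by (simp add: suspension_coord_def)
  qed
  then show ?thesis using \<delta>(1) by blast
qed

end

section \<open>Assembly of the equivalences\<close>

theorem theorem4p3:
  fixes l :: "'a::metric_space set"
  assumes "compact l"
  shows "(admits_kinematic_expansive_suspension l id \<longleftrightarrow>
            (\<exists>T::'a \<Rightarrow> real. continuous_on l T \<and>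
               (\<exists>\<delta>>0. \<forall>x\<in>l. \<forall>y\<in>l. 0 < dist x y \<and> dist x y < \<delta> \<longrightarrow> T x \<noteq> T y))) \<and>
         ((\<exists>T::'a \<Rightarrow> real. continuous_on l T \<and>
               (\<exists>\<delta>>0. \<forall>x\<in>l. \<forall>y\<in>l. 0 < dist x y \<and> dist x y < \<delta> \<longrightarrow> T x \<noteq> T y)) \<longleftrightarrow>
            (\<exists>S::real set. l homeomorphic S))"
    (is "(?expansive \<longleftrightarrow> ?locally_injective) \<and> (_ \<longleftrightarrow> ?embeds)")
proof (intro conjI iffI)
  assume ?expansive
  then obtain T \<phi> d where T: "suspension_flow l id T \<phi>"
      "Metric_space (suspension_space l id T) d"
      "Metric_space.mtopology (suspension_space l id T) d = suspension_topology l id T"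
      "kinematic_expansive (suspension_space l id T) d \<phi>"
    by (auto simp: admits_kinematic_expansive_suspension_def)
  then have cont: "continuous_on l T" and "\<And>x. x \<in> l \<Longrightarrow> 0 < T x"
    by (auto simp: suspension_flow_def)
  then interpret positive_roof l T
    using assms by unfold_locales
  show ?locally_injective
    using cont kinematic_expansive_imp_locally_injective_roof[OF T] by blast
next
  assume ?locally_injective
  then obtain T :: "'a \<Rightarrow> real" and \<delta> where T: "continuous_on l T" "0 < \<delta>"
      and inj: "\<forall>x\<in>l. \<forall>y\<in>l. 0 < dist x y \<and> dist x y < \<delta> \<longrightarrow> T x \<noteq> T y"
    by blast
  obtain b where b: "\<And>x. x \<in> l \<Longrightarrow> \<bar>T x\<bar> \<le> b"
    using compact_imp_bounded[OF compact_continuous_image[OF T(1) assms]] by (auto simp: bounded_iff)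
  \<comment> \<open>Adding \<open>b + 1\<close> makes the return time positive and leaves
    differences of values, hence local injectivity, unchanged.\<close>
  interpret positive_roof l "\<lambda>x. T x + (b + 1)"
  proof
    show "continuous_on l (\<lambda>x. T x + (b + 1))"
      by (intro continuous_intros T(1))
    show "0 < T x + (b + 1)" if "x \<in> l" for x
      using b[OF that] by linarith
  qed (rule assms)
  show ?expansive
  proof (rule admits_kinematic_expansive_suspension_id[OF T(2)])
    fix x y assume "x \<in> l" "y \<in> l" "0 < dist x y" "dist x y < \<delta>"
    then have "T x \<noteq> T y"
      using inj by blast
    then show "T x + (b + 1) \<noteq> T y + (b + 1)"
      by simp
  qed
next
  assume ?locally_injective
  then obtain T :: "'a \<Rightarrow> real" and \<delta> where T: "continuous_on l T" "0 < \<delta>"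
      and inj: "\<forall>x\<in>l. \<forall>y\<in>l. 0 < dist x y \<and> dist x y < \<delta> \<longrightarrow> T x \<noteq> T y"
    by blast
  show ?embeds
  proof (rule locally_injective_imp_homeomorphic_real_subset[OF assms T])
    fix x y assume "x \<in> l" "y \<in> l" "0 < dist x y" "dist x y < \<delta>"
    then show "T x \<noteq> T y"
      using inj by blast
  qed
next
  assume ?embeds
  then obtain S h g where h: "homeomorphism l (S::real set) h g"
    by (auto simp: homeomorphic_def)
  then have "continuous_on l h" and inv: "\<And>x. x \<in> l \<Longrightarrow> g (h x) = x"
    by (auto simp: homeomorphism_def)
  \<comment> \<open>\<open>h\<close> is injective on all of \<open>l\<close>, so the radius 1 is an
    arbitrary choice.\<close>
  moreover have "\<forall>x\<in>l. \<forall>y\<in>l. 0 < dist x y \<and> dist x y < 1 \<longrightarrow> h x \<noteq> h y"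
    using inv by (metis dist_self less_irrefl)
  ultimately show ?locally_injective
    using zero_less_one by blast
qed

end
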